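(* (The Numerical Zig-zag Lemma.) Let $\mathfrak C$ be a left-exact ranked category with kernels and let $\epsilon$ be a real number. Let $A$, $B$, $C$ be chain complexes in $\mathfrak C$, $$A:\ A_0=0\xrightarrow{a_0}A_1\xrightarrow{a_1}A_2\xrightarrow{a_2}\cdots,\quad B:\ B_0=0\xrightarrow{b_0}B_1\xrightarrow{b_1}B_2\xrightarrow{b_2}\cdots,\quad C:\ C_0=0\xrightarrow{c_0}C_1\xrightarrow{c_1}C_2\xrightarrow{c_2}\cdots,$$ and let $f_k:A_k\to B_k$, $g_k:B_k\to C_k$ ($k\ge0$) be morphisms such that $f_{k+1}\circ a_k=b_k\circ f_k$ and $g_{k+1}\circ b_k=c_k\circ g_k$ for all $k\ge 0$. Suppose that for each $k\ge 0$ the sequence $A_k\xrightarrow{f_k}B_k\xrightarrow{g_k}C_k$ is $\epsilon$-additive. Let $$(e_k)_{k=0}^\infty=(h_\bullet^0(A),h_\bullet^0(B),h_\bullet^0(C),h_\bullet^1(A),h_\bullet^1(B),h_\bullet^1(C),h_\bullet^2(A),\ldots).$$ Then for all $k\ge 0$, $$\sum_{j=0}^k(-1)^j e_{k-j}\ge -(k+1)\epsilon.$$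
   Context: A category with kernels is a category with a zero object in which every morphism has a kernel; $\ker(f)$ denotes a kernel morphism and $\mathrm{Ker}(f)$ its domain. A zero morphism (denoted $0$) is one factoring through a zero object. A rank on a category is a function $\mathrm{rk}$ from its morphisms to the nonnegative reals such that for all $f:A\to B$, $g:B\to C$: $\mathrm{rk}(g\circ f)\le\mathrm{rk}(f)$ and $\mathrm{rk}(g\circ f)\le\mathrm{rk}(g)$. A ranked category is a category equipped with a rank. Write $\ell(A)=\mathrm{rk}(\mathrm{id}_A)$ and, in a ranked category with kernels, $\mathrm{nul}(f)=\ell(\mathrm{Ker}(f))$ (independent of the choice of kernel). The rank is left-exact if $\mathrm{rk}(f)=\ell(A)-\mathrm{nul}(f)$ for every morphism $f:A\to B$. A chain complex is a sequence $0\xrightarrow{a_0}A_1\xrightarrow{a_1}A_2\xrightarrow{a_2}\cdots$ with $a_{i+1}\circ a_i=0$ for all $i$. For such a chain complex $A$ and $k\ge0$, $h_\bullet^k(A):=\mathrm{nul}(a_{k+1})-\mathrm{rk}(a_k)$. A sequence $A\xrightarrow{f}B\xrightarrow{g}C$ is $\epsilon$-additive if $f$ is a kernel of $g$ and $\ell(C)-\ell(B)+\ell(A)\le\epsilon$. *)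

theory Defs
  imports Complex_Main
begin

text \<open>The fields of a category record are only meaningful on the carriers \<open>Obj\<close> and \<open>Mor\<close>,
  and \<open>Comp\<close> only on composable pairs. Composition is written in the usual order:
  \<open>g \<cdot> f\<close> is \<open>g\<close> after \<open>f\<close>.\<close>

record ('o, 'm) cat =
  Obj :: "'o set"
  Mor :: "'m set"
  Dom :: "'m \<Rightarrow> 'o"
  Cod :: "'m \<Rightarrow> 'o"
  Id :: "'o \<Rightarrow> 'm"
  Comp :: "'m \<Rightarrow> 'm \<Rightarrow> 'm" (infixl \<open>\<cdot>\<index>\<close> 70)

definition Hom :: "('o, 'm, 'x) cat_scheme \<Rightarrow> 'o \<Rightarrow> 'o \<Rightarrow> 'm set" where
  "Hom \<CC> A B = {f \<in> Mor \<CC>. Dom \<CC> f = A \<and> Cod \<CC> f = B}"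

locale category =
  fixes \<CC> :: "('o, 'm, 'x) cat_scheme" (structure)
  assumes Dom_Obj: "f \<in> Mor \<CC> \<Longrightarrow> Dom \<CC> f \<in> Obj \<CC>"
    and Cod_Obj: "f \<in> Mor \<CC> \<Longrightarrow> Cod \<CC> f \<in> Obj \<CC>"
    and Id_Hom: "A \<in> Obj \<CC> \<Longrightarrow> Id \<CC> A \<in> Hom \<CC> A A"
    and Comp_Hom: "\<lbrakk>f \<in> Hom \<CC> A B; g \<in> Hom \<CC> B C\<rbrakk> \<Longrightarrow> g \<cdot> f \<in> Hom \<CC> A C"
    and Comp_Id: "f \<in> Hom \<CC> A B \<Longrightarrow> f \<cdot> Id \<CC> A = f"
    and Id_Comp: "f \<in> Hom \<CC> A B \<Longrightarrow> Id \<CC> B \<cdot> f = f"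
    and Comp_assoc: "\<lbrakk>f \<in> Hom \<CC> A B; g \<in> Hom \<CC> B C; h \<in> Hom \<CC> C D\<rbrakk>
      \<Longrightarrow> (h \<cdot> g) \<cdot> f = h \<cdot> (g \<cdot> f)"

definition zero_object :: "('o, 'm, 'x) cat_scheme \<Rightarrow> 'o \<Rightarrow> bool" where
  "zero_object \<CC> Z \<longleftrightarrow> Z \<in> Obj \<CC> \<and>
    (\<forall>A \<in> Obj \<CC>. (\<exists>!f. f \<in> Hom \<CC> Z A) \<and> (\<exists>!f. f \<in> Hom \<CC> A Z))"

definition zero_morphism :: "('o, 'm, 'x) cat_scheme \<Rightarrow> 'm \<Rightarrow> bool" where
  "zero_morphism \<CC> f \<longleftrightarrow> f \<in> Mor \<CC> \<and>
    (\<exists>Z u v. zero_object \<CC> Z \<and> u \<in> Hom \<CC> (Dom \<CC> f) Z \<and> v \<in> Hom \<CC> Z (Cod \<CC> f)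
      \<and> f = v \<cdot>\<^bsub>\<CC>\<^esub> u)"

definition is_kernel :: "('o, 'm, 'x) cat_scheme \<Rightarrow> 'm \<Rightarrow> 'm \<Rightarrow> bool" where
  "is_kernel \<CC> i f \<longleftrightarrow> i \<in> Mor \<CC> \<and> f \<in> Mor \<CC> \<and> Cod \<CC> i = Dom \<CC> f
    \<and> zero_morphism \<CC> (f \<cdot>\<^bsub>\<CC>\<^esub> i)
    \<and> (\<forall>h \<in> Mor \<CC>. Cod \<CC> h = Dom \<CC> f \<longrightarrow> zero_morphism \<CC> (f \<cdot>\<^bsub>\<CC>\<^esub> h) \<longrightarrow>
        (\<exists>!u. u \<in> Hom \<CC> (Dom \<CC> h) (Dom \<CC> i) \<and> i \<cdot>\<^bsub>\<CC>\<^esub> u = h))"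

definition ker :: "('o, 'm, 'x) cat_scheme \<Rightarrow> 'm \<Rightarrow> 'm" where
  "ker \<CC> f = (SOME i. is_kernel \<CC> i f)"

definition Ker :: "('o, 'm, 'x) cat_scheme \<Rightarrow> 'm \<Rightarrow> 'o" where
  "Ker \<CC> f = Dom \<CC> (ker \<CC> f)"

locale category_with_kernels = category +
  assumes ex_zero_object: "\<exists>Z. zero_object \<CC> Z"
    and ex_kernel: "f \<in> Mor \<CC> \<Longrightarrow> \<exists>i. is_kernel \<CC> i f"

locale ranked_category = category +
  fixes rk :: "'b \<Rightarrow> real"
  assumes rk_nonneg: "f \<in> Mor \<CC> \<Longrightarrow> 0 \<le> rk f"
    and rk_Comp_right: "\<lbrakk>f \<in> Hom \<CC> A B; g \<in> Hom \<CC> B C\<rbrakk> \<Longrightarrow> rk (g \<cdot> f) \<le> rk f"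
    and rk_Comp_left: "\<lbrakk>f \<in> Hom \<CC> A B; g \<in> Hom \<CC> B C\<rbrakk> \<Longrightarrow> rk (g \<cdot> f) \<le> rk g"

definition len :: "('o, 'm, 'x) cat_scheme \<Rightarrow> ('m \<Rightarrow> real) \<Rightarrow> 'o \<Rightarrow> real" where
  "len \<CC> rk A = rk (Id \<CC> A)"

definition nul :: "('o, 'm, 'x) cat_scheme \<Rightarrow> ('m \<Rightarrow> real) \<Rightarrow> 'm \<Rightarrow> real" where
  "nul \<CC> rk f = len \<CC> rk (Ker \<CC> f)"

lemma (in ranked_category) nul_eq_len_kernel:
  assumes i: "is_kernel \<CC> i f"
  shows "nul \<CC> rk f = len \<CC> rk (Dom \<CC> i)"
proof -
  have le: "len \<CC> rk (Dom \<CC> i) \<le> len \<CC> rk (Dom \<CC> j)"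
    if i: "is_kernel \<CC> i f" and j: "is_kernel \<CC> j f" for i j
  proof -
    have iH: "i \<in> Hom \<CC> (Dom \<CC> i) (Dom \<CC> f)" and jH: "j \<in> Hom \<CC> (Dom \<CC> j) (Dom \<CC> f)"
      using i j by (auto simp: is_kernel_def Hom_def)
    obtain u where u: "u \<in> Hom \<CC> (Dom \<CC> i) (Dom \<CC> j)" "j \<cdot> u = i"
      using i j unfolding is_kernel_def by blast
    obtain v where v: "v \<in> Hom \<CC> (Dom \<CC> j) (Dom \<CC> i)" "i \<cdot> v = j"
      using i j unfolding is_kernel_def by blast
    have vu: "v \<cdot> u \<in> Hom \<CC> (Dom \<CC> i) (Dom \<CC> i)" "i \<cdot> (v \<cdot> u) = i"
      using Comp_Hom[OF u(1) v(1)] Comp_assoc[OF u(1) v(1) iH] u(2) v(2) by auto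
    have I: "Id \<CC> (Dom \<CC> i) \<in> Hom \<CC> (Dom \<CC> i) (Dom \<CC> i)" "i \<cdot> Id \<CC> (Dom \<CC> i) = i"
      using i iH Comp_Id by (auto simp: is_kernel_def intro!: Id_Hom Dom_Obj)
    have "\<exists>!w. w \<in> Hom \<CC> (Dom \<CC> i) (Dom \<CC> i) \<and> i \<cdot> w = i"
      using i unfolding is_kernel_def by blast
    then have eq: "Id \<CC> (Dom \<CC> i) = v \<cdot> u" using vu I by blast
    have J: "Id \<CC> (Dom \<CC> j) \<in> Hom \<CC> (Dom \<CC> j) (Dom \<CC> j)"
      using j by (auto simp: is_kernel_def intro!: Id_Hom Dom_Obj)
    have "rk (v \<cdot> u) \<le> rk u" using rk_Comp_right[OF u(1) v(1)] .
    also have "\<dots> \<le> rk (Id \<CC> (Dom \<CC> j))"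
      using rk_Comp_left[OF u(1) J] Id_Comp[OF u(1)] by simp
    finally show ?thesis unfolding len_def eq .
  qed
  have "is_kernel \<CC> (ker \<CC> f) f" unfolding ker_def using i by (rule someI)
  then show ?thesis unfolding nul_def Ker_def using le i by (simp add: order_antisym)
qed

locale left_exact_ranked_category_with_kernels =
  category_with_kernels \<CC> + ranked_category \<CC> rk
  for \<CC> :: "('o, 'm, 'x) cat_scheme" (structure) and rk :: "'m \<Rightarrow> real" +
  assumes left_exact: "f \<in> Hom \<CC> A B \<Longrightarrow> rk f = len \<CC> rk A - nul \<CC> rk f"

text \<open>The object in degree 0 may be any zero object; no particular one is singled out.\<close>

definition chain_complex ::
    "('o, 'm, 'x) cat_scheme \<Rightarrow> (nat \<Rightarrow> 'o) \<Rightarrow> (nat \<Rightarrow> 'm) \<Rightarrow> bool" where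
  "chain_complex \<CC> A a \<longleftrightarrow> zero_object \<CC> (A 0)
    \<and> (\<forall>k. a k \<in> Hom \<CC> (A k) (A (Suc k)))
    \<and> (\<forall>k. zero_morphism \<CC> (a (Suc k) \<cdot>\<^bsub>\<CC>\<^esub> a k))"

definition num_homology ::
    "('o, 'm, 'x) cat_scheme \<Rightarrow> ('m \<Rightarrow> real) \<Rightarrow> (nat \<Rightarrow> 'm) \<Rightarrow> nat \<Rightarrow> real" where
  "num_homology \<CC> rk a k = nul \<CC> rk (a (Suc k)) - rk (a k)"

definition additive_seq ::
    "('o, 'm, 'x) cat_scheme \<Rightarrow> ('m \<Rightarrow> real) \<Rightarrow> real \<Rightarrow> 'o \<Rightarrow> 'm \<Rightarrow> 'o \<Rightarrow> 'm \<Rightarrow> 'o \<Rightarrow> bool" where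
  "additive_seq \<CC> rk \<epsilon> A f B g C \<longleftrightarrow> f \<in> Hom \<CC> A B \<and> g \<in> Hom \<CC> B C
    \<and> is_kernel \<CC> f g \<and> len \<CC> rk C - len \<CC> rk B + len \<CC> rk A \<le> \<epsilon>"

end

theory Submission
  imports Defs
begin

text \<open>Write \<open>\<delta>\<^sub>k = \<ell>(A\<^sub>k) - \<ell>(B\<^sub>k) + \<ell>(C\<^sub>k)\<close> and \<open>\<rho>\<^sub>k = rk a\<^sub>k - rk b\<^sub>k + rk c\<^sub>k\<close>. Left-exactness gives
  \<open>0 \<le> \<delta>\<^sub>k \<le> \<epsilon>\<close>, and one period of the alternating sum is
  \<open>h\<^sup>k(C) - h\<^sup>k(B) + h\<^sup>k(A) = \<delta>\<^sub>k\<^sub>+\<^sub>1 - \<rho>\<^sub>k\<^sub>+\<^sub>1 - \<rho>\<^sub>k\<close>, so the \<open>\<rho>\<close>'s telescope and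
  \<open>\<rho>\<^sub>0 = 0\<close>. What remains are the three rank estimates that replace exactness of the long exact
  sequence: \<open>nul a\<^sub>k\<^sub>+\<^sub>1 \<ge> rk b\<^sub>k - rk c\<^sub>k\<close>,
  \<open>nul b\<^sub>k\<^sub>+\<^sub>1 - nul a\<^sub>k\<^sub>+\<^sub>1 \<ge> rk c\<^sub>k - \<delta>\<^sub>k\<close> and \<open>nul b\<^sub>k - nul a\<^sub>k \<le> nul c\<^sub>k\<close>.\<close>

section \<open>Zero morphisms and kernels\<close>

context category
begin

lemma Hom_Obj: "f \<in> Hom \<CC> A B \<Longrightarrow> A \<in> Obj \<CC>" "f \<in> Hom \<CC> A B \<Longrightarrow> B \<in> Obj \<CC>"
  using Dom_Obj Cod_Obj by (auto simp: Hom_def)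

lemma zero_morphism_iff:
  assumes "f \<in> Hom \<CC> A B"
  shows "zero_morphism \<CC> f \<longleftrightarrow>
    (\<exists>Z u v. zero_object \<CC> Z \<and> u \<in> Hom \<CC> A Z \<and> v \<in> Hom \<CC> Z B \<and> f = v \<cdot> u)"
  using assms by (auto simp: zero_morphism_def Hom_def)

lemma zero_object_Hom_unique:
  assumes "zero_object \<CC> Z"
  shows "u \<in> Hom \<CC> A Z \<Longrightarrow> u' \<in> Hom \<CC> A Z \<Longrightarrow> u = u'"
    and "v \<in> Hom \<CC> Z A \<Longrightarrow> v' \<in> Hom \<CC> Z A \<Longrightarrow> v = v'"
proof -
  show "u = u'" if "u \<in> Hom \<CC> A Z" "u' \<in> Hom \<CC> A Z"
    using assms Hom_Obj(1)[OF that(1)] that unfolding zero_object_def by metis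
  show "v = v'" if "v \<in> Hom \<CC> Z A" "v' \<in> Hom \<CC> Z A"
    using assms Hom_Obj(2)[OF that(1)] that unfolding zero_object_def by metis
qed

text \<open>The two factorizations may use different zero objects; a map \<open>t\<close> between
  these identifies both composites with \<open>v' \<cdot> t \<cdot> u\<close>.\<close>

lemma zero_morphism_unique:
  assumes f: "f \<in> Hom \<CC> A B" "zero_morphism \<CC> f" and g: "g \<in> Hom \<CC> A B" "zero_morphism \<CC> g"
  shows "f = g"
proof -
  obtain Z u v where 1: "zero_object \<CC> Z" "u \<in> Hom \<CC> A Z" "v \<in> Hom \<CC> Z B" "f = v \<cdot> u"
    using f(2) unfolding zero_morphism_iff[OF f(1)] by blast
  obtain Z' u' v' where 2: "zero_object \<CC> Z'" "u' \<in> Hom \<CC> A Z'" "v' \<in> Hom \<CC> Z' B" "g = v' \<cdot> u'"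
    using g(2) unfolding zero_morphism_iff[OF g(1)] by blast
  obtain t where t: "t \<in> Hom \<CC> Z Z'"
    using 1(1) 2(1) unfolding zero_object_def by (meson ex1_implies_ex)
  have "v = v' \<cdot> t"
    using zero_object_Hom_unique(2)[OF 1(1) 1(3) Comp_Hom[OF t 2(3)]] .
  moreover have "u' = t \<cdot> u"
    using zero_object_Hom_unique(1)[OF 2(1) 2(2) Comp_Hom[OF 1(2) t]] .
  ultimately show ?thesis
    using 1(4) 2(4) Comp_assoc[OF 1(2) t 2(3)] by simp
qed

lemma zero_morphism_comp_left:
  assumes f: "f \<in> Hom \<CC> A B" "zero_morphism \<CC> f" and h: "h \<in> Hom \<CC> B C"
  shows "zero_morphism \<CC> (h \<cdot> f)"
proof -
  obtain Z u v where 1: "zero_object \<CC> Z" "u \<in> Hom \<CC> A Z" "v \<in> Hom \<CC> Z B" "f = v \<cdot> u"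
    using f(2) unfolding zero_morphism_iff[OF f(1)] by blast
  have "h \<cdot> f = (h \<cdot> v) \<cdot> u" using Comp_assoc[OF 1(2,3) h] 1(4) by simp
  then show ?thesis
    unfolding zero_morphism_iff[OF Comp_Hom[OF f(1) h]] using 1(1,2) Comp_Hom[OF 1(3) h] by blast
qed

lemma zero_morphism_comp_right:
  assumes f: "f \<in> Hom \<CC> B C" "zero_morphism \<CC> f" and h: "h \<in> Hom \<CC> A B"
  shows "zero_morphism \<CC> (f \<cdot> h)"
proof -
  obtain Z u v where 1: "zero_object \<CC> Z" "u \<in> Hom \<CC> B Z" "v \<in> Hom \<CC> Z C" "f = v \<cdot> u"
    using f(2) unfolding zero_morphism_iff[OF f(1)] by blast
  have "f \<cdot> h = v \<cdot> (u \<cdot> h)" using Comp_assoc[OF h 1(2,3)] 1(4) by simp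
  then show ?thesis
    unfolding zero_morphism_iff[OF Comp_Hom[OF h f(1)]] using 1(1,3) Comp_Hom[OF h 1(2)] by blast
qed

lemma kernel_Hom: "is_kernel \<CC> i f \<Longrightarrow> f \<in> Hom \<CC> A B \<Longrightarrow> i \<in> Hom \<CC> (Dom \<CC> i) A"
  by (auto simp: is_kernel_def Hom_def)

lemma kernel_zero: "is_kernel \<CC> i f \<Longrightarrow> zero_morphism \<CC> (f \<cdot> i)"
  by (simp add: is_kernel_def)

lemma kernel_factor:
  assumes "is_kernel \<CC> i f" "f \<in> Hom \<CC> A B" "h \<in> Hom \<CC> X A" "zero_morphism \<CC> (f \<cdot> h)"
  obtains u where "u \<in> Hom \<CC> X (Dom \<CC> i)" "i \<cdot> u = h"
  using assms unfolding is_kernel_def Hom_def by fast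

text \<open>Kernels are monic: \<open>f\<close> annihilates \<open>i \<cdot> x\<close>, so the
  uniqueness half of the universal property applies to that morphism.\<close>

lemma kernel_cancel:
  assumes i: "is_kernel \<CC> i f"
    and x: "x \<in> Hom \<CC> X (Dom \<CC> i)" and y: "y \<in> Hom \<CC> X (Dom \<CC> i)" and eq: "i \<cdot> x = i \<cdot> y"
  shows "x = y"
proof -
  have f: "f \<in> Hom \<CC> (Dom \<CC> f) (Cod \<CC> f)" using i by (simp add: is_kernel_def Hom_def)
  note iH = kernel_Hom[OF i f]
  have ix: "i \<cdot> x \<in> Hom \<CC> X (Dom \<CC> f)" using Comp_Hom[OF x iH] .
  have "zero_morphism \<CC> (f \<cdot> (i \<cdot> x))"
    using zero_morphism_comp_right[OF Comp_Hom[OF iH f] kernel_zero[OF i] x] Comp_assoc[OF x iH f]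
    by simp
  then have "\<exists>!u. u \<in> Hom \<CC> X (Dom \<CC> i) \<and> i \<cdot> u = i \<cdot> x"
    using i ix unfolding is_kernel_def Hom_def by fast
  then show ?thesis using x y eq by metis
qed

text \<open>Separates unique factorization into existence and left cancellation, the form in which
  diagram chases deliver it.\<close>

lemma kernelI:
  assumes "i \<in> Hom \<CC> K A" "f \<in> Hom \<CC> A B" "zero_morphism \<CC> (f \<cdot> i)"
    and "\<And>X h. h \<in> Hom \<CC> X A \<Longrightarrow> zero_morphism \<CC> (f \<cdot> h) \<Longrightarrow> \<exists>u. u \<in> Hom \<CC> X K \<and> i \<cdot> u = h"
    and "\<And>X u v. u \<in> Hom \<CC> X K \<Longrightarrow> v \<in> Hom \<CC> X K \<Longrightarrow> i \<cdot> u = i \<cdot> v \<Longrightarrow> u = v"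
  shows "is_kernel \<CC> i f"
proof -
  have "\<exists>!u. u \<in> Hom \<CC> (Dom \<CC> h) K \<and> i \<cdot> u = h"
    if "h \<in> Mor \<CC>" "Cod \<CC> h = A" "zero_morphism \<CC> (f \<cdot> h)" for h
    using assms(4)[of h "Dom \<CC> h"] assms(5) that by (auto simp: Hom_def)
  then show ?thesis using assms(1,2,3) by (auto simp: is_kernel_def Hom_def)
qed

text \<open>Seen as subobjects, the kernel of \<open>h\<close> already lies inside that of
  \<open>g\<close>, so restricting \<open>h\<close> along \<open>\<kappa>\<close> leaves its kernel
  unchanged.\<close>

lemma kernel_restrict:
  assumes k: "is_kernel \<CC> \<kappa> g" and i: "is_kernel \<CC> i h"
    and g: "g \<in> Hom \<CC> B C" and h: "h \<in> Hom \<CC> B D"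
    and p: "p \<in> Hom \<CC> (Dom \<CC> i) (Dom \<CC> \<kappa>)" and kp: "\<kappa> \<cdot> p = i"
  shows "is_kernel \<CC> p (h \<cdot> \<kappa>)"
proof -
  note kH = kernel_Hom[OF k g] and iH = kernel_Hom[OF i h]
  show ?thesis
  proof (rule kernelI[OF p Comp_Hom[OF kH h]])
    show "zero_morphism \<CC> (h \<cdot> \<kappa> \<cdot> p)"
      using Comp_assoc[OF p kH h] kp kernel_zero[OF i] by simp
  next
    fix X x assume x: "x \<in> Hom \<CC> X (Dom \<CC> \<kappa>)" and "zero_morphism \<CC> (h \<cdot> \<kappa> \<cdot> x)"
    then have "zero_morphism \<CC> (h \<cdot> (\<kappa> \<cdot> x))" using Comp_assoc[OF x kH h] by simp
    then obtain u where u: "u \<in> Hom \<CC> X (Dom \<CC> i)" "i \<cdot> u = \<kappa> \<cdot> x"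
      using kernel_factor[OF i h Comp_Hom[OF x kH]] by blast
    have "\<kappa> \<cdot> (p \<cdot> u) = \<kappa> \<cdot> x" using Comp_assoc[OF u(1) p kH] kp u(2) by simp
    then have "p \<cdot> u = x" using kernel_cancel[OF k Comp_Hom[OF u(1) p] x] by blast
    then show "\<exists>u. u \<in> Hom \<CC> X (Dom \<CC> i) \<and> p \<cdot> u = x" using u(1) by blast
  next
    fix X u v
    assume uv: "u \<in> Hom \<CC> X (Dom \<CC> i)" "v \<in> Hom \<CC> X (Dom \<CC> i)" "p \<cdot> u = p \<cdot> v"
    then have "i \<cdot> u = i \<cdot> v"
      using Comp_assoc[OF uv(1) p kH] Comp_assoc[OF uv(2) p kH] kp by simp
    then show "u = v" using kernel_cancel[OF i] uv(1,2) by blast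
  qed
qed

end

section \<open>Kernels along commuting squares\<close>

context category_with_kernels
begin

lemma ex_zero_morphism:
  assumes "A \<in> Obj \<CC>" "B \<in> Obj \<CC>"
  obtains z where "z \<in> Hom \<CC> A B" "zero_morphism \<CC> z"
proof -
  obtain Z where Z: "zero_object \<CC> Z" using ex_zero_object by blast
  obtain u v where uv: "u \<in> Hom \<CC> A Z" "v \<in> Hom \<CC> Z B"
    using Z assms unfolding zero_object_def by (meson ex1_implies_ex)
  show thesis
  proof (rule that[OF Comp_Hom[OF uv]])
    show "zero_morphism \<CC> (v \<cdot> u)"
      unfolding zero_morphism_iff[OF Comp_Hom[OF uv]] using Z uv by blast
  qed
qed

text \<open>A zero morphism \<open>o'\<close> parallel to \<open>x\<close> exists, \<open>i\<close>
  sends both to the same zero morphism, and \<open>i\<close> is monic.\<close>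

lemma kernel_reflects_zero:
  assumes i: "is_kernel \<CC> i f" and x: "x \<in> Hom \<CC> X (Dom \<CC> i)" and z: "zero_morphism \<CC> (i \<cdot> x)"
  shows "zero_morphism \<CC> x"
proof -
  have f: "f \<in> Hom \<CC> (Dom \<CC> f) (Cod \<CC> f)" using i by (simp add: is_kernel_def Hom_def)
  note iH = kernel_Hom[OF i f]
  obtain o' where o': "o' \<in> Hom \<CC> X (Dom \<CC> i)" "zero_morphism \<CC> o'"
    using ex_zero_morphism Hom_Obj[OF x] by blast
  have "i \<cdot> o' = i \<cdot> x"
    using zero_morphism_unique[OF Comp_Hom[OF o'(1) iH] zero_morphism_comp_left[OF o' iH]
        Comp_Hom[OF x iH] z] .
  then show ?thesis using kernel_cancel[OF i o'(1) x] o'(2) by blast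
qed

text \<open>The left-exact beginning of the snake lemma: the kernel of \<open>a\<close>, mapped into
  that of \<open>b\<close> by the morphism \<open>p\<close> that \<open>f\<close> induces, is
  exactly what \<open>g\<close> annihilates there.\<close>

lemma kernel_of_square:
  assumes ker_f: "is_kernel \<CC> f g" and ker_f': "is_kernel \<CC> f' g'"
    and f: "f \<in> Hom \<CC> A B" and g: "g \<in> Hom \<CC> B C" and f': "f' \<in> Hom \<CC> A' B'"
    and a: "a \<in> Hom \<CC> A A'" and b: "b \<in> Hom \<CC> B B'" and sq: "f' \<cdot> a = b \<cdot> f"
    and i: "is_kernel \<CC> i a" and j: "is_kernel \<CC> j b"
  obtains p where "p \<in> Hom \<CC> (Dom \<CC> i) (Dom \<CC> j)" "is_kernel \<CC> p (g \<cdot> j)"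
proof -
  note iH = kernel_Hom[OF i a] and jH = kernel_Hom[OF j b]
  have Af: "Dom \<CC> f = A" and Af': "Dom \<CC> f' = A'" using f f' by (auto simp: Hom_def)
  have "b \<cdot> (f \<cdot> i) = f' \<cdot> (a \<cdot> i)"
    using Comp_assoc[OF iH f b] Comp_assoc[OF iH a f'] sq by simp
  then have "zero_morphism \<CC> (b \<cdot> (f \<cdot> i))"
    using zero_morphism_comp_left[OF Comp_Hom[OF iH a] kernel_zero[OF i] f'] by simp
  then obtain p where p: "p \<in> Hom \<CC> (Dom \<CC> i) (Dom \<CC> j)" "j \<cdot> p = f \<cdot> i"
    using kernel_factor[OF j b Comp_Hom[OF iH f]] by blast
  have "is_kernel \<CC> p (g \<cdot> j)"
  proof (rule kernelI[OF p(1) Comp_Hom[OF jH g]])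
    have "g \<cdot> j \<cdot> p = g \<cdot> f \<cdot> i"
      using Comp_assoc[OF p(1) jH g] Comp_assoc[OF iH f g] p(2) by simp
    then show "zero_morphism \<CC> (g \<cdot> j \<cdot> p)"
      using zero_morphism_comp_right[OF Comp_Hom[OF f g] kernel_zero[OF ker_f] iH] by simp
  next
    fix X x assume x: "x \<in> Hom \<CC> X (Dom \<CC> j)" and "zero_morphism \<CC> (g \<cdot> j \<cdot> x)"
    then have "zero_morphism \<CC> (g \<cdot> (j \<cdot> x))" using Comp_assoc[OF x jH g] by simp
    then obtain y where y: "y \<in> Hom \<CC> X A" "f \<cdot> y = j \<cdot> x"
      using kernel_factor[OF ker_f g Comp_Hom[OF x jH]] Af by blast
    \<comment> \<open>The lift \<open>y\<close> of \<open>j \<cdot> x\<close> along \<open>f\<close>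
      must be shown to land in the kernel of \<open>a\<close>; as \<open>f'\<close> reflects zero
      morphisms, this can be tested after applying \<open>f'\<close>.\<close>
    have "f' \<cdot> (a \<cdot> y) = b \<cdot> j \<cdot> x"
      using Comp_assoc[OF y(1) a f'] Comp_assoc[OF y(1) f b] Comp_assoc[OF x jH b] sq y(2) by simp
    then have "zero_morphism \<CC> (f' \<cdot> (a \<cdot> y))"
      using zero_morphism_comp_right[OF Comp_Hom[OF jH b] kernel_zero[OF j] x] by simp
    then have "zero_morphism \<CC> (a \<cdot> y)"
      using kernel_reflects_zero[OF ker_f'] Comp_Hom[OF y(1) a] Af' by blast
    then obtain u where u: "u \<in> Hom \<CC> X (Dom \<CC> i)" "i \<cdot> u = y"
      using kernel_factor[OF i a y(1)] by blast
    have "j \<cdot> (p \<cdot> u) = j \<cdot> x"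
      using Comp_assoc[OF u(1) p(1) jH] Comp_assoc[OF u(1) iH f] p(2) u(2) y(2) by simp
    then have "p \<cdot> u = x" using kernel_cancel[OF j Comp_Hom[OF u(1) p(1)] x] by blast
    then show "\<exists>u. u \<in> Hom \<CC> X (Dom \<CC> i) \<and> p \<cdot> u = x" using u(1) by blast
  next
    fix X u v
    assume uv: "u \<in> Hom \<CC> X (Dom \<CC> i)" "v \<in> Hom \<CC> X (Dom \<CC> i)" "p \<cdot> u = p \<cdot> v"
    have "f \<cdot> (i \<cdot> u) = j \<cdot> (p \<cdot> u)" "f \<cdot> (i \<cdot> v) = j \<cdot> (p \<cdot> v)"
      using Comp_assoc[OF uv(1) p(1) jH] Comp_assoc[OF uv(1) iH f]
        Comp_assoc[OF uv(2) p(1) jH] Comp_assoc[OF uv(2) iH f] p(2) by simp_all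
    then have "i \<cdot> u = i \<cdot> v"
      using kernel_cancel[OF ker_f, of "i \<cdot> u" X "i \<cdot> v"] uv Comp_Hom[OF uv(1) iH]
        Comp_Hom[OF uv(2) iH] Af by simp
    then show "u = v" using kernel_cancel[OF i] uv(1,2) by blast
  qed
  then show thesis using that p(1) by blast
qed

end

section \<open>Rank and nullity estimates\<close>

lemma (in ranked_category) rk_le_len:
  assumes f: "f \<in> Hom \<CC> A B"
  shows "rk f \<le> len \<CC> rk A" "rk f \<le> len \<CC> rk B"
  using rk_Comp_right[OF Id_Hom f] rk_Comp_left[OF f Id_Hom] Comp_Id[OF f] Id_Comp[OF f]
    Hom_Obj[OF f] by (auto simp: len_def)

context left_exact_ranked_category_with_kernels
begin

lemma rk_kernel:
  assumes "is_kernel \<CC> i f" "f \<in> Hom \<CC> A B"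
  shows "rk f = len \<CC> rk A - len \<CC> rk (Dom \<CC> i)"
  using left_exact[OF assms(2)] nul_eq_len_kernel[OF assms(1)] by simp

lemma rk_from_zero_object:
  assumes Z: "zero_object \<CC> Z" and f: "f \<in> Hom \<CC> Z B"
  shows "rk f = 0"
proof -
  have ZO: "Z \<in> Obj \<CC>" using Hom_Obj[OF f] by blast
  have I: "Id \<CC> Z \<in> Hom \<CC> Z Z" using Id_Hom ZO .
  have zero: "zero_morphism \<CC> h" if "h \<in> Hom \<CC> X Z" for h X
    unfolding zero_morphism_iff[OF that] using Id_Comp[OF that, symmetric] that I Z by blast
  \<comment> \<open>The identity of \<open>Z\<close> is itself a zero morphism, hence its own
    kernel, and left-exactness then reads \<open>len Z = len Z - len Z\<close>.\<close>
  have "is_kernel \<CC> (Id \<CC> Z) (Id \<CC> Z)"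
  proof (rule kernelI[OF I I])
    show "zero_morphism \<CC> (Id \<CC> Z \<cdot> Id \<CC> Z)" using zero Comp_Hom[OF I I] .
  next
    fix X h assume "h \<in> Hom \<CC> X Z"
    then show "\<exists>u. u \<in> Hom \<CC> X Z \<and> Id \<CC> Z \<cdot> u = h" using Id_Comp by blast
  next
    fix X u v assume "u \<in> Hom \<CC> X Z" "v \<in> Hom \<CC> X Z"
    then show "u = v" using zero_object_Hom_unique(1)[OF Z] by blast
  qed
  then have "len \<CC> rk Z = 0"
    using rk_kernel[of "Id \<CC> Z", OF _ I] I by (simp add: len_def Hom_def)
  then show ?thesis using rk_le_len(1)[OF f] rk_nonneg[of f] f by (simp add: Hom_def)
qed

text \<open>The morphism \<open>h\<close> factors through the kernel of \<open>f\<close>, whose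
  \<open>len\<close> bounds the rank of everything passing through it.\<close>

lemma rk_le_nul:
  assumes h: "h \<in> Hom \<CC> X A" and f: "f \<in> Hom \<CC> A B" and z: "zero_morphism \<CC> (f \<cdot> h)"
  shows "rk h \<le> nul \<CC> rk f"
proof -
  obtain i where i: "is_kernel \<CC> i f" using ex_kernel f by (auto simp: Hom_def)
  obtain u where u: "u \<in> Hom \<CC> X (Dom \<CC> i)" "i \<cdot> u = h" using kernel_factor[OF i f h z] .
  show ?thesis
    using rk_Comp_right[OF u(1) kernel_Hom[OF i f]] rk_le_len(2)[OF u(1)] u(2)
      nul_eq_len_kernel[OF i] by simp
qed

text \<open>Restricting \<open>h\<close> to the kernel of \<open>g \<cdot> h\<close> keeps the
  kernel of \<open>h\<close> (\<open>kernel_restrict\<close>), so left-exactness expresses all three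
  ranks by the same \<open>len\<close> values.\<close>

lemma rk_comp_kernel:
  assumes h: "h \<in> Hom \<CC> A B" and g: "g \<in> Hom \<CC> B C" and k: "is_kernel \<CC> \<kappa> (g \<cdot> h)"
  shows "rk (h \<cdot> \<kappa>) = rk h - rk (g \<cdot> h)"
proof -
  note gh = Comp_Hom[OF h g]
  note kH = kernel_Hom[OF k gh]
  obtain i where i: "is_kernel \<CC> i h" using ex_kernel h by (auto simp: Hom_def)
  note iH = kernel_Hom[OF i h]
  have "zero_morphism \<CC> (g \<cdot> h \<cdot> i)"
    using zero_morphism_comp_left[OF Comp_Hom[OF iH h] kernel_zero[OF i] g] Comp_assoc[OF iH h g]
    by simp
  then obtain p where p: "p \<in> Hom \<CC> (Dom \<CC> i) (Dom \<CC> \<kappa>)" "\<kappa> \<cdot> p = i"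
    using kernel_factor[OF k gh iH] by blast
  have "rk (h \<cdot> \<kappa>) = len \<CC> rk (Dom \<CC> \<kappa>) - len \<CC> rk (Dom \<CC> i)"
    using rk_kernel[OF kernel_restrict[OF k i gh h p] Comp_Hom[OF kH h]] p(1)
    by (simp add: Hom_def)
  then show ?thesis using rk_kernel[OF i h] rk_kernel[OF k gh] by simp
qed

text \<open>Sylvester's rank inequality: the rank lost from \<open>h\<close> to
  \<open>g \<cdot> h\<close> is the rank of \<open>h \<cdot> \<kappa>\<close>, which
  \<open>g\<close> annihilates.\<close>

lemma rk_comp_ge:
  assumes h: "h \<in> Hom \<CC> A B" and g: "g \<in> Hom \<CC> B C"
  shows "rk h - nul \<CC> rk g \<le> rk (g \<cdot> h)"
proof -
  note gh = Comp_Hom[OF h g]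
  obtain \<kappa> where k: "is_kernel \<CC> \<kappa> (g \<cdot> h)" using ex_kernel gh by (auto simp: Hom_def)
  note kH = kernel_Hom[OF k gh]
  have "zero_morphism \<CC> (g \<cdot> (h \<cdot> \<kappa>))" using kernel_zero[OF k] Comp_assoc[OF kH h g] by simp
  then show ?thesis using rk_le_nul[OF Comp_Hom[OF kH h] g] rk_comp_kernel[OF h g k] by simp
qed

lemma rk_kernel_of_square:
  assumes "is_kernel \<CC> f g" "is_kernel \<CC> f' g'"
    and "f \<in> Hom \<CC> A B" and g: "g \<in> Hom \<CC> B C" and "f' \<in> Hom \<CC> A' B'"
    and a: "a \<in> Hom \<CC> A A'" and b: "b \<in> Hom \<CC> B B'" and "f' \<cdot> a = b \<cdot> f"
    and j: "is_kernel \<CC> j b"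
  shows "rk (g \<cdot> j) = nul \<CC> rk b - nul \<CC> rk a"
proof -
  obtain i where i: "is_kernel \<CC> i a" using ex_kernel a by (auto simp: Hom_def)
  obtain p where p: "p \<in> Hom \<CC> (Dom \<CC> i) (Dom \<CC> j)" "is_kernel \<CC> p (g \<cdot> j)"
    using kernel_of_square[OF assms(1-8) i j] .
  have "Dom \<CC> p = Dom \<CC> i" using p(1) by (simp add: Hom_def)
  then show ?thesis
    using rk_kernel[OF p(2) Comp_Hom[OF kernel_Hom[OF j b] g]]
      nul_eq_len_kernel[OF i] nul_eq_len_kernel[OF j] by simp
qed

text \<open>The left side is the rank of \<open>g \<cdot> j\<close>, and commutativity makes
  \<open>c\<close> annihilate that morphism.\<close>

lemma nul_square_le:
  assumes "is_kernel \<CC> f g" "is_kernel \<CC> f' g'"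
    and "f \<in> Hom \<CC> A B" and g: "g \<in> Hom \<CC> B C"
    and "f' \<in> Hom \<CC> A' B'" and g': "g' \<in> Hom \<CC> B' C'"
    and a: "a \<in> Hom \<CC> A A'" and b: "b \<in> Hom \<CC> B B'" and c: "c \<in> Hom \<CC> C C'"
    and "f' \<cdot> a = b \<cdot> f" and sq: "g' \<cdot> b = c \<cdot> g"
  shows "nul \<CC> rk b - nul \<CC> rk a \<le> nul \<CC> rk c"
proof -
  obtain j where j: "is_kernel \<CC> j b" using ex_kernel b by (auto simp: Hom_def)
  note jH = kernel_Hom[OF j b]
  have "c \<cdot> (g \<cdot> j) = g' \<cdot> (b \<cdot> j)"
    using Comp_assoc[OF jH g c] Comp_assoc[OF jH b g'] sq by simp
  then have "zero_morphism \<CC> (c \<cdot> (g \<cdot> j))"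
    using zero_morphism_comp_left[OF Comp_Hom[OF jH b] kernel_zero[OF j] g'] by simp
  then show ?thesis
    using rk_le_nul[OF Comp_Hom[OF jH g] c]
      rk_kernel_of_square[OF assms(1-3) g assms(5) a b assms(10) j] by simp
qed

text \<open>On the kernel of \<open>g' \<cdot> b\<close> the morphism \<open>b\<close> lifts along
  \<open>f'\<close> to \<open>y\<close>, a substitute for the connecting morphism. The lift is
  annihilated by \<open>a'\<close>, while \<open>rk y\<close> is at least
  \<open>rk (b \<cdot> \<kappa>) = rk b - rk (g' \<cdot> b)\<close>.\<close>

lemma rk_connecting_le_nul:
  assumes ker_f': "is_kernel \<CC> f' g'" and ker_f'': "is_kernel \<CC> f'' g''"
    and f': "f' \<in> Hom \<CC> A' B'" and f'': "f'' \<in> Hom \<CC> A'' B''"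
    and g: "g \<in> Hom \<CC> B C" and g': "g' \<in> Hom \<CC> B' C'"
    and a': "a' \<in> Hom \<CC> A' A''" and b: "b \<in> Hom \<CC> B B'" and b': "b' \<in> Hom \<CC> B' B''"
    and c: "c \<in> Hom \<CC> C C'"
    and sqf: "f'' \<cdot> a' = b' \<cdot> f'" and sqg: "g' \<cdot> b = c \<cdot> g"
    and bb: "zero_morphism \<CC> (b' \<cdot> b)"
  shows "rk b - rk c \<le> nul \<CC> rk a'"
proof -
  note gb = Comp_Hom[OF b g']
  have Af: "Dom \<CC> f' = A'" "Dom \<CC> f'' = A''" using f' f'' by (auto simp: Hom_def)
  obtain \<kappa> where k: "is_kernel \<CC> \<kappa> (g' \<cdot> b)" using ex_kernel gb by (auto simp: Hom_def)
  note kH = kernel_Hom[OF k gb]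
  have "zero_morphism \<CC> (g' \<cdot> (b \<cdot> \<kappa>))" using kernel_zero[OF k] Comp_assoc[OF kH b g'] by simp
  then obtain y where y: "y \<in> Hom \<CC> (Dom \<CC> \<kappa>) A'" "f' \<cdot> y = b \<cdot> \<kappa>"
    using kernel_factor[OF ker_f' g' Comp_Hom[OF kH b]] Af by metis
  have "f'' \<cdot> (a' \<cdot> y) = b' \<cdot> b \<cdot> \<kappa>"
    using Comp_assoc[OF y(1) a' f''] Comp_assoc[OF y(1) f' b'] Comp_assoc[OF kH b b'] sqf y(2)
    by simp
  then have "zero_morphism \<CC> (f'' \<cdot> (a' \<cdot> y))"
    using zero_morphism_comp_right[OF Comp_Hom[OF b b'] bb kH] by simp
  then have "zero_morphism \<CC> (a' \<cdot> y)"
    using kernel_reflects_zero[OF ker_f''] Comp_Hom[OF y(1) a'] Af by blast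
  then have "rk y \<le> nul \<CC> rk a'" using rk_le_nul[OF y(1) a'] by blast
  moreover have "rk (b \<cdot> \<kappa>) \<le> rk y" using rk_Comp_right[OF y(1) f'] y(2) by simp
  moreover have "rk (g' \<cdot> b) \<le> rk c" using rk_Comp_left[OF g c] sqg by simp
  ultimately show ?thesis using rk_comp_kernel[OF b g' k] by simp
qed

text \<open>As \<open>b\<close> factors through the kernel \<open>j\<close> of \<open>b'\<close>,
  the rank of \<open>c \<cdot> g = g' \<cdot> b\<close> is at most that of
  \<open>g' \<cdot> j\<close>. By \<open>rk_comp_ge\<close> it is at least
  \<open>rk g - nul c\<close>, which left-exactness turns into \<open>rk c\<close> minus the
  additivity defect.\<close>

lemma rk_connecting_ge:
  assumes ker_f: "is_kernel \<CC> f g" and ker_f': "is_kernel \<CC> f' g'" and ker_f'': "is_kernel \<CC> f'' g''"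
    and f: "f \<in> Hom \<CC> A B" and f': "f' \<in> Hom \<CC> A' B'" and f'': "f'' \<in> Hom \<CC> A'' B''"
    and g: "g \<in> Hom \<CC> B C" and g': "g' \<in> Hom \<CC> B' C'"
    and a': "a' \<in> Hom \<CC> A' A''" and b: "b \<in> Hom \<CC> B B'" and b': "b' \<in> Hom \<CC> B' B''"
    and c: "c \<in> Hom \<CC> C C'"
    and sqf: "f'' \<cdot> a' = b' \<cdot> f'" and sqg: "g' \<cdot> b = c \<cdot> g"
    and bb: "zero_morphism \<CC> (b' \<cdot> b)"
  shows "rk c - (len \<CC> rk A - len \<CC> rk B + len \<CC> rk C) \<le> nul \<CC> rk b' - nul \<CC> rk a'"
proof -
  obtain j where j: "is_kernel \<CC> j b'" using ex_kernel b' by (auto simp: Hom_def)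
  note jH = kernel_Hom[OF j b']
  obtain s where s: "s \<in> Hom \<CC> B (Dom \<CC> j)" "j \<cdot> s = b" using kernel_factor[OF j b' b bb] .
  have "c \<cdot> g = g' \<cdot> j \<cdot> s" using Comp_assoc[OF s(1) jH g'] s(2) sqg by simp
  then have "rk (c \<cdot> g) \<le> rk (g' \<cdot> j)" using rk_Comp_left[OF s(1) Comp_Hom[OF jH g']] by simp
  moreover have "rk (g' \<cdot> j) = nul \<CC> rk b' - nul \<CC> rk a'"
    using rk_kernel_of_square[OF ker_f' ker_f'' f' g' f'' a' b' sqf j] .
  moreover have "rk g = len \<CC> rk B - len \<CC> rk A"
    using rk_kernel[OF ker_f g] f by (simp add: Hom_def)
  ultimately show ?thesis using rk_comp_ge[OF g c] left_exact[OF c] by simp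
qed

end

section \<open>Assembling the alternating sums\<close>

lemma alternating_sum_Suc:
  fixes e :: "nat \<Rightarrow> real"
  shows "(\<Sum>j = 0..Suc k. (-1) ^ j * e (Suc k - j)) = e (Suc k) - (\<Sum>j = 0..k. (-1) ^ j * e (k - j))"
  by (simp add: sum.atLeast0_atMost_Suc_shift sum_negf del: sum.cl_ivl_Suc)

theorem theorem6p1:
  fixes \<CC> :: "('o, 'm, 'x) cat_scheme" (structure)
    and rk :: "'m \<Rightarrow> real"
    and \<epsilon> :: real
    and A B C :: "nat \<Rightarrow> 'o"
    and a b c f g :: "nat \<Rightarrow> 'm"
    and e :: "nat \<Rightarrow> real"
  assumes "left_exact_ranked_category_with_kernels \<CC> rk"
    and "chain_complex \<CC> A a" and "chain_complex \<CC> B b" and "chain_complex \<CC> C c"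
    and "\<And>k. f k \<in> Hom \<CC> (A k) (B k)"
    and "\<And>k. g k \<in> Hom \<CC> (B k) (C k)"
    and "\<And>k. f (Suc k) \<cdot> a k = b k \<cdot> f k"
    and "\<And>k. g (Suc k) \<cdot> b k = c k \<cdot> g k"
    and "\<And>k. additive_seq \<CC> rk \<epsilon> (A k) (f k) (B k) (g k) (C k)"
    and "\<And>k. e (3 * k) = num_homology \<CC> rk a k"
    and "\<And>k. e (3 * k + 1) = num_homology \<CC> rk b k"
    and "\<And>k. e (3 * k + 2) = num_homology \<CC> rk c k"
  shows "\<forall>k. (\<Sum>j = 0..k. (-1) ^ j * e (k - j)) \<ge> - (real k + 1) * \<epsilon>"
proof -
  interpret left_exact_ranked_category_with_kernels \<CC> rk by fact
  note f = assms(5) and g = assms(6) and sqf = assms(7) and sqg = assms(8)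
  have a: "a k \<in> Hom \<CC> (A k) (A (Suc k))" and b: "b k \<in> Hom \<CC> (B k) (B (Suc k))"
    and c: "c k \<in> Hom \<CC> (C k) (C (Suc k))" and bb: "zero_morphism \<CC> (b (Suc k) \<cdot> b k)" for k
    using assms(2-4) by (auto simp: chain_complex_def)
  have start: "rk (a 0) = 0" "rk (b 0) = 0" "rk (c 0) = 0"
    using rk_from_zero_object[OF _ a] rk_from_zero_object[OF _ b] rk_from_zero_object[OF _ c]
      assms(2-4) by (auto simp: chain_complex_def)
  have kf: "is_kernel \<CC> (f k) (g k)" for k using assms(9) by (simp add: additive_seq_def)
  define \<delta> where "\<delta> k = len \<CC> rk (A k) - len \<CC> rk (B k) + len \<CC> rk (C k)" for k
  define \<rho> where "\<rho> k = rk (a k) - rk (b k) + rk (c k)" for k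
  define S where "S k = (\<Sum>j = 0..k. (-1) ^ j * e (k - j))" for k
  have \<delta>_le: "\<delta> k \<le> \<epsilon>" for k using assms(9)[of k] by (simp add: additive_seq_def \<delta>_def)
  \<comment> \<open>Left-exactness and the kernel \<open>f k\<close> give
    \<open>\<delta> k = len (C k) - rk (g k)\<close>.\<close>
  have \<delta>_ge: "0 \<le> \<delta> k" for k
    using rk_kernel[OF kf g, of k] rk_le_len(2)[OF g, of k] f[of k] by (simp add: \<delta>_def Hom_def)
  have \<epsilon>: "0 \<le> \<epsilon>" using \<delta>_ge \<delta>_le order_trans by blast
  have ineq_A: "rk (b k) - rk (c k) \<le> nul \<CC> rk (a (Suc k))" for k
    using rk_connecting_le_nul[OF kf kf f f g g a b b c sqf sqg bb] .
  have ineq_B: "rk (c k) - \<delta> k \<le> nul \<CC> rk (b (Suc k)) - nul \<CC> rk (a (Suc k))" for k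
    unfolding \<delta>_def using rk_connecting_ge[OF kf kf kf f f f g g a b b c sqf sqg bb] .
  have nul: "nul \<CC> rk (a k) = len \<CC> rk (A k) - rk (a k)"
    "nul \<CC> rk (b k) = len \<CC> rk (B k) - rk (b k)"
    "nul \<CC> rk (c k) = len \<CC> rk (C k) - rk (c k)" for k
    using left_exact[OF a[of k]] left_exact[OF b[of k]] left_exact[OF c[of k]] by simp_all
  have ineq_C: "\<rho> k \<le> \<delta> k" for k
    using nul_square_le[OF kf kf f g f g a b c sqf sqg, of k] nul[of k] by (simp add: \<rho>_def \<delta>_def)
  have S_Suc: "S (Suc k) = e (Suc k) - S k" for k
    unfolding S_def by (rule alternating_sum_Suc)
  have S_0: "S 0 = nul \<CC> rk (a (Suc 0)) - rk (a 0)"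
    using assms(10)[of 0] by (simp add: S_def num_homology_def)
  have S_A: "S (3 * Suc k) = nul \<CC> rk (a (Suc (Suc k))) - rk (a (Suc k)) - S (3 * k + 2)" for k
    using S_Suc[of "3 * k + 2"] assms(10)[of "Suc k"]
    by (simp add: num_homology_def eval_nat_numeral)
  have S_B: "S (3 * k + 1) = nul \<CC> rk (b (Suc k)) - rk (b k) - S (3 * k)" for k
    using S_Suc[of "3 * k"] assms(11)[of k] by (simp add: num_homology_def)
  have S_C: "S (3 * k + 2) = nul \<CC> rk (c (Suc k)) - rk (c k) - S (3 * k + 1)" for k
    using S_Suc[of "3 * k + 1"] assms(12)[of k] by (simp add: num_homology_def)
  text \<open>\<open>- D k\<close> is the alternating sum of the defects \<open>\<delta>\<^sub>k, \<dots>, \<delta>\<^sub>1\<close>.\<close>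
  define D where "D k = S (3 * k) - nul \<CC> rk (a (Suc k)) + rk (b k) - rk (c k)" for k
  have D_0: "D 0 = 0" using S_0 start by (simp add: D_def)
  \<comment> \<open>The rank terms of degree \<open>k\<close> cancel against those built into
    \<open>D k\<close>; only nullities of degree \<open>Suc k\<close> remain, and left-exactness
    splits them into \<delta> and \<rho>.\<close>
  have S_C_D: "S (3 * k + 2) = \<delta> (Suc k) - \<rho> (Suc k) + D k" for k
    using S_B[of k] S_C[of k] nul[of "Suc k"] by (simp add: D_def \<delta>_def \<rho>_def)
  have D_Suc: "D (Suc k) = - \<delta> (Suc k) - D k" for k
    using S_A[of k] S_C_D[of k] by (simp add: D_def \<rho>_def)
  \<comment> \<open>The recursion flips the sign of \<open>D\<close>, so the induction needs a
    two-sided bound.\<close>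
  have D_bound: "\<bar>D k\<bar> \<le> real k * \<epsilon>" for k
  proof (induction k)
    case 0
    show ?case using D_0 by simp
  next
    case (Suc k)
    then show ?case
      using D_Suc[of k] \<delta>_ge[of "Suc k"] \<delta>_le[of "Suc k"] by (simp add: algebra_simps)
  qed
  have bound: "- (real k + 1) * \<epsilon> \<le> S k" for k
  proof -
    define q where "q = k div 3"
    consider "k = 3 * q" | "k = 3 * q + 1" | "k = 3 * q + 2"
      unfolding q_def by linarith
    \<comment> \<open>Each residue class modulo 3 uses one rank estimate: it gives
      \<open>S k \<ge> D q\<close> in the classes 0 and 2, and
      \<open>S k \<ge> - \<delta> q - D q\<close> in class 1.\<close>
    then have "- (real q + 1) * \<epsilon> \<le> S k"
    proof cases
      case 1
      have "- (real q * \<epsilon>) \<le> S (3 * q)"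
        using D_bound[of q] ineq_A[of q] by (simp add: D_def)
      then show ?thesis using 1 \<epsilon> by (simp add: algebra_simps)
    next
      case 2
      have "- \<epsilon> - real q * \<epsilon> \<le> S (3 * q + 1)"
        using D_bound[of q] ineq_B[of q] \<delta>_le[of q] S_B[of q] by (simp add: D_def)
      then show ?thesis using 2 by (simp add: algebra_simps)
    next
      case 3
      have "- (real q * \<epsilon>) \<le> S (3 * q + 2)"
        using D_bound[of q] ineq_C[of "Suc q"] S_C_D[of q] by simp
      then show ?thesis using 3 \<epsilon> by (simp add: algebra_simps)
    qed
    \<comment> \<open>The sharper constant \<open>q + 1\<close> weakens to \<open>k + 1\<close>
      because \<epsilon>, which bounds a nonnegative defect, is itself nonnegative.\<close>
    moreover have "(real q + 1) * \<epsilon> \<le> (real k + 1) * \<epsilon>"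
      using \<epsilon> by (intro mult_right_mono) (simp_all add: q_def)
    ultimately show ?thesis unfolding mult_minus_left by linarith
  qed
  then show ?thesis by (simp add: S_def)
qed

end
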